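(* Let $S$ be a semigroup and let $x\in S$. The set $C(x)$ is a connected component of $\Gamma(S)$. Moreover, the connected components of the graph $\Gamma(S)$ are precisely the members of $\{C(x) : x\in S\}$.
   Context: For a subset $X$ of a semigroup $S$, $\langle X\rangle$ denotes the subsemigroup generated by $X$; a semigroup is monogenic if it equals $\langle a\rangle=\{a^k : k\in\mathbb{N}\}$ for some element $a$, where $\mathbb{N}=\{1,2,\dots\}$. The cyclic graph $\Gamma(S)$ is the simple undirected graph with vertex set $S$ in which two distinct vertices $x,y$ are adjacent if and only if $\langle x,y\rangle$ is a monogenic subsemigroup of $S$. For $x\in S$ and $m,n\in\mathbb{N}$, $S(x,m,n)=\{y\in S : x^m=y^n\}$, and $C(x)=\bigcup_{m,n\in\mathbb{N}} S(x,m,n)$. Connected components are identified with their vertex sets. *)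

theory Defs
  imports Graph_Theory.Digraph_Component
begin

text \<open>
  A semigroup is a type of class \<^class>\<open>semigroup_mult\<close>; the semigroup itself is \<^term>\<open>UNIV\<close>.
\<close>

text \<open>
  Without an identity element there is no zeroth power, and the library's power operation is
  unavailable. The exponent is meant to be positive (at 0 the function takes the value \<open>x\<close>).
\<close>

definition spow :: "'a::semigroup_mult \<Rightarrow> nat \<Rightarrow> 'a" where
  "spow x n = (((*) x) ^^ (n - 1)) x"

lemma spow_1: "spow x 1 = x"
  by (simp add: spow_def)

lemma spow_Suc: "n \<ge> 1 \<Longrightarrow> spow x (Suc n) = x * spow x n"
  by (cases n) (simp_all add: spow_def)

inductive_set subsemigroup_gen :: "'a::semigroup_mult set \<Rightarrow> 'a set"
  for X :: "'a set" where
  base: "x \<in> X \<Longrightarrow> x \<in> subsemigroup_gen X"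
| mult: "\<lbrakk>x \<in> subsemigroup_gen X; y \<in> subsemigroup_gen X\<rbrakk> \<Longrightarrow> x * y \<in> subsemigroup_gen X"

definition monogenic :: "'a::semigroup_mult set \<Rightarrow> bool" where
  "monogenic T \<longleftrightarrow> (\<exists>a. T = subsemigroup_gen {a})"

lemma spow_add:
  assumes "m \<ge> 1" "n \<ge> 1"
  shows "spow x m * spow x n = spow x (m + n)"
  using assms(1)
proof (induction m rule: dec_induct)
  case base
  then show ?case using assms(2) spow_Suc[of n x] by (simp add: spow_1[simplified])
next
  case (step m)
  then show ?case using assms(2) spow_Suc[of m x] spow_Suc[of "m + n" x] by (simp add: mult.assoc)
qed

lemma subsemigroup_gen_singleton: "subsemigroup_gen {a} = {spow a k | k. k \<ge> 1}"
proof (intro set_eqI iffI)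
  fix z assume "z \<in> subsemigroup_gen {a}"
  then show "z \<in> {spow a k | k. k \<ge> 1}"
  proof induction
    case (base x)
    then show ?case using spow_1[of a] by force
  next
    case (mult x y)
    then obtain m n where "m \<ge> 1" "n \<ge> 1" "x = spow a m" "y = spow a n" by blast
    then have "x * y = spow a (m + n)" "m + n \<ge> 1" using spow_add by auto
    then show ?case by blast
  qed
next
  fix z assume "z \<in> {spow a k | k. k \<ge> 1}"
  then obtain k where k: "k \<ge> 1" "z = spow a k" by blast
  from k(1) have "spow a k \<in> subsemigroup_gen {a}"
  proof (induction k rule: dec_induct)
    case base
    show ?case unfolding spow_1 by (simp add: subsemigroup_gen.base)
  next
    case (step n)
    then show ?case
      using spow_Suc[of n a] by (simp add: subsemigroup_gen.base subsemigroup_gen.mult)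
  qed
  with k show "z \<in> subsemigroup_gen {a}" by simp
qed

text \<open>
  As usual in the graph library, an undirected edge between \<open>x\<close> and \<open>y\<close> is represented by the two
  arcs \<open>(x, y)\<close> and \<open>(y, x)\<close>.
\<close>

definition cyclic_graph :: "'a::semigroup_mult pair_pre_digraph" where
  "cyclic_graph =
     \<lparr> pverts = UNIV,
       parcs = {(x, y). x \<noteq> y \<and> monogenic (subsemigroup_gen {x, y})} \<rparr>"

lemma cyclic_graph_simple:
  "pair_bidirected_digraph (cyclic_graph :: 'a::semigroup_mult pair_pre_digraph)"
  by unfold_locales
     (auto simp: cyclic_graph_def symmetric_def insert_commute intro!: symI)

definition connected_components :: "'a pair_pre_digraph \<Rightarrow> 'a set set" where
  "connected_components G =
     verts ` {H. pre_digraph.max_subgraph (with_proj G) connected H}"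

definition power_set_at :: "'a::semigroup_mult \<Rightarrow> nat \<Rightarrow> nat \<Rightarrow> 'a set" where
  "power_set_at x m n = {y. spow x m = spow y n}"

definition power_class :: "'a::semigroup_mult \<Rightarrow> 'a set" where
  "power_class x = (\<Union>m\<in>{1..}. \<Union>n\<in>{1..}. power_set_at x m n)"

end

theory Submission
  imports Defs
begin

text \<open>
  That \<open>y\<close> lies in \<open>power_class x\<close> means that \<open>x\<close> and \<open>y\<close> have a common power with positive
  exponents. The proof identifies this relation with reachability in the cyclic graph.

  If \<open>x\<close> and \<open>y\<close> are adjacent, both are powers of some \<open>a\<close>, say \<open>x = a\<^sup>i\<close> and \<open>y = a\<^sup>j\<close>, and then
  \<open>x\<^sup>j = y\<^sup>i\<close> (\<open>monogenic_pair_common_power\<close>). Having a common power is transitive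
  (\<open>power_class_trans\<close>), because common powers of \<open>x, y\<close> and of \<open>y, z\<close> can be raised to a common
  exponent of \<open>y\<close>. Hence every walk stays inside one class. Conversely \<open>x\<close> is adjacent or equal to
  each of its powers, as \<open>\<langle>x, x\<^sup>m\<rangle> = \<langle>x\<rangle>\<close>; if \<open>x\<^sup>m = y\<^sup>n\<close>, then \<open>x, x\<^sup>m = y\<^sup>n, y\<close> is therefore a
  path up to repeated vertices, and the two elements are connected by a walk of length at most two.

  Components are maximal connected subgraphs, so it remains to pass from these to reachability
  classes. In a symmetric digraph the maximal connected subgraphs are the strongly connected
  components (\<open>max_connected_eq_sccs\<close>), whose vertex sets are the classes of mutual reachability.
\<close>

section \<open>Components of symmetric digraphs\<close>

lemma (in wf_digraph) strongly_connected_imp_connected: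
  "strongly_connected G \<Longrightarrow> connected G"
  unfolding connected_def strongly_connected_def
  by (auto intro: reachable_mk_symmetricI)

lemma arc_mono_connected: "arc_mono connected"
  unfolding arc_mono_def
  by (metis spanning_def subgraphE wf_digraph.connected_spanning_imp_connected)

text \<open>
  Passing to the subgraph induced on the same vertices preserves connectedness, and an induced
  subgraph of a symmetric digraph is symmetric, so that for it the two notions of connectedness
  agree. So no strongly connected component can be enlarged to a connected subgraph: the subgraph
  induced on the larger vertex set would be strongly connected.
\<close>

lemma (in sym_digraph) max_connected_eq_sccs:
  "{H. max_subgraph connected H} = sccs"
proof (intro set_eqI iffI)
  fix H assume "H \<in> {H. max_subgraph connected H}"
  then have max: "max_subgraph connected H" by simp
  then have sub: "subgraph H G" and conn: "connected H"
    by (simp_all add: max_subgraph_def)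
  have "induced_subgraph H G"
    using max arc_mono_connected by (rule induced_subgraphI_arc_mono)
  with sym_arcs have "symmetric H"
    by (rule induced_graph_imp_symmetric)
  then have "strongly_connected H"
    using sub conn by (auto intro: wf_digraph.symmetric_connected_imp_strongly_connected)
  then have "max_subgraph strongly_connected H"
    using max unfolding max_subgraph_def
    by (meson subgraphE wf_digraph.strongly_connected_imp_connected)
  then show "H \<in> sccs" by (simp add: sccs_altdef2)
next
  fix H assume "H \<in> sccs"
  then have ind: "induced_subgraph H G" and sc: "strongly_connected H"
    and max: "\<And>K. induced_subgraph K G \<Longrightarrow> strongly_connected K \<Longrightarrow> \<not> verts H \<subset> verts K"
    by (auto simp: sccs_def)
  have sub: "subgraph H G" using ind by (rule induced_imp_subgraph)
  have "max_subgraph connected H"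
  proof (rule max_subgraphI)
    show "connected H"
      using sub sc by (auto intro: wf_digraph.strongly_connected_imp_connected)
    show "subgraph H G" by (fact sub)
  next
    fix K assume ne: "H \<noteq> K" and HK: "subgraph H K" and KG: "subgraph K G"
    show "\<not> connected K"
    proof
      assume K: "connected K"
      let ?L = "G \<restriction> verts K"
      have ind': "induced_subgraph ?L G"
        using KG by (intro induced_induce) auto
      have "connected ?L"
        using arc_mono_connected K subgraph_induce_subgraphI2[OF KG]
        unfolding arc_mono_def by (metis induce_subgraph_verts)
      moreover have "symmetric ?L"
        using sym_arcs ind' by (rule induced_graph_imp_symmetric)
      ultimately have "strongly_connected ?L"
        using wf_digraphI_induced[OF ind']
        by (intro wf_digraph.symmetric_connected_imp_strongly_connected)
      from max[OF ind' this] have "verts H = verts K"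
        using HK by auto
      moreover from this have "arcs K \<subseteq> arcs H"
        using ind KG by (auto simp: induced_subgraph_altdef)
      ultimately have "H = K"
        using HK by (auto simp: subgraph_def compatible_def)
      with ne show False ..
    qed
  qed
  then show "H \<in> {H. max_subgraph connected H}" by simp
qed

lemma connected_components_eq_reachable_classes:
  assumes "pair_sym_digraph G"
  shows "connected_components G = (\<lambda>u. {v. u \<rightarrow>\<^sup>*\<^bsub>with_proj G\<^esub> v}) ` pverts G"
proof -
  interpret pair_sym_digraph G by fact
  have sym: "sym_digraph (with_proj G)" by unfold_locales
  have "scc_of = (\<lambda>u. {v. u \<rightarrow>\<^sup>*\<^bsub>with_proj G\<^esub> v})"
    using symmetric_reachable' by (auto simp: scc_of_def fun_eq_iff)
  moreover have "connected_components G = sccs_verts"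
    unfolding connected_components_def sym_digraph.max_connected_eq_sccs[OF sym]
      sccs_verts_conv by simp
  ultimately show ?thesis
    by (simp add: sccs_verts_conv_scc_of)
qed

section \<open>Elements with a common power\<close>

lemma spow_spow:
  assumes "m \<ge> 1" "n \<ge> 1"
  shows "spow (spow x m) n = spow x (m * n)"
  using assms(2)
proof (induction n rule: dec_induct)
  case base
  show ?case by (simp add: spow_1[simplified])
next
  case (step n)
  have "spow (spow x m) (Suc n) = spow x m * spow x (m * n)"
    using step spow_Suc[of n "spow x m"] by simp
  also have "\<dots> = spow x (m + m * n)"
    using assms(1) step by (intro spow_add) auto
  finally show ?case by simp
qed

lemma power_class_iff:
  "y \<in> power_class x \<longleftrightarrow> (\<exists>m\<ge>1. \<exists>n\<ge>1. spow x m = spow y n)"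
  unfolding power_class_def power_set_at_def by auto

lemma power_class_refl: "x \<in> power_class x"
  unfolding power_class_iff by blast

lemma power_class_trans:
  assumes "y \<in> power_class x" "z \<in> power_class y"
  shows "z \<in> power_class x"
proof -
  from assms obtain m n k l where
    pos: "m \<ge> 1" "n \<ge> 1" "k \<ge> 1" "l \<ge> 1"
    and xy: "spow x m = spow y n" and yz: "spow y k = spow z l"
    unfolding power_class_iff by blast
  \<comment> \<open>Both equations are raised to the exponent that makes the power of \<open>y\<close> equal to \<open>y\<^sup>n\<^sup>k\<close>.\<close>
  have "spow x (m * k) = spow (spow y n) k"
    using pos by (simp add: spow_spow flip: xy)
  also have "\<dots> = spow (spow y k) n"
    using pos by (simp add: spow_spow mult.commute)
  also have "\<dots> = spow z (l * n)"
    using pos by (simp add: spow_spow yz)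
  finally have "spow x (m * k) = spow z (l * n)" .
  moreover have "m * k \<ge> 1" "l * n \<ge> 1" using pos by auto
  ultimately show ?thesis unfolding power_class_iff by blast
qed

section \<open>Walks in the cyclic graph\<close>

lemma monogenic_pair_common_power:
  assumes "monogenic (subsemigroup_gen {x, y})"
  shows "y \<in> power_class x"
proof -
  from assms obtain a where "subsemigroup_gen {x, y} = subsemigroup_gen {a}"
    unfolding monogenic_def by blast
  then have "x \<in> subsemigroup_gen {a}" "y \<in> subsemigroup_gen {a}"
    by (auto intro: subsemigroup_gen.base)
  then obtain i j where "i \<ge> 1" "j \<ge> 1" "x = spow a i" "y = spow a j"
    unfolding subsemigroup_gen_singleton by blast
  then have "spow x j = spow y i"
    by (simp add: spow_spow mult.commute)
  then show ?thesis
    using \<open>i \<ge> 1\<close> \<open>j \<ge> 1\<close> unfolding power_class_iff by blast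
qed

lemma subsemigroup_gen_insert_absorb:
  assumes "y \<in> subsemigroup_gen X"
  shows "subsemigroup_gen (insert y X) = subsemigroup_gen X"
proof (intro equalityI subsetI)
  fix z assume "z \<in> subsemigroup_gen (insert y X)"
  then show "z \<in> subsemigroup_gen X"
    by induction (use assms in \<open>auto intro: subsemigroup_gen.intros\<close>)
next
  fix z assume "z \<in> subsemigroup_gen X"
  then show "z \<in> subsemigroup_gen (insert y X)"
    by induction (auto intro: subsemigroup_gen.intros)
qed

lemma monogenic_insert_spow:
  assumes "m \<ge> 1"
  shows "monogenic (subsemigroup_gen {spow x m, x})"
proof -
  have "spow x m \<in> subsemigroup_gen {x}"
    using assms unfolding subsemigroup_gen_singleton by blast
  then show ?thesis
    unfolding monogenic_def using subsemigroup_gen_insert_absorb by blast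
qed

lemma cyclic_graph_reachable_iff:
  fixes x y :: "'a::semigroup_mult"
  shows "x \<rightarrow>\<^sup>*\<^bsub>with_proj cyclic_graph\<^esub> y \<longleftrightarrow> y \<in> power_class x"
proof -
  interpret pair_bidirected_digraph "cyclic_graph :: 'a pair_pre_digraph"
    by (rule cyclic_graph_simple)
  have vertex: "z \<in> pverts cyclic_graph" for z :: 'a
    by (simp add: cyclic_graph_def)
  show ?thesis
  proof
    assume "x \<rightarrow>\<^sup>*\<^bsub>with_proj cyclic_graph\<^esub> y"
    then show "y \<in> power_class x"
    proof (induction rule: reachable_induct)
      case base
      show ?case by (rule power_class_refl)
    next
      case (step y z)
      then have "z \<in> power_class y"
        by (auto simp: cyclic_graph_def intro: monogenic_pair_common_power)
      with step.IH show ?case by (rule power_class_trans)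
    qed
  next
    have to_power: "z \<rightarrow>\<^sup>*\<^bsub>with_proj cyclic_graph\<^esub> spow z m" if "m \<ge> 1" for z :: 'a and m
    proof (cases "spow z m = z")
      \<comment> \<open>The graph has no loops, so an element equal to its power is joined to it by the empty walk.\<close>
      case True
      then show ?thesis using vertex by simp
    next
      case False
      then have "(z, spow z m) \<in> parcs cyclic_graph"
        using monogenic_insert_spow[OF that, of z]
        by (auto simp: cyclic_graph_def insert_commute)
      then show ?thesis by (intro reachable_adjI) simp
    qed
    assume "y \<in> power_class x"
    then obtain m n where "m \<ge> 1" "n \<ge> 1" and eq: "spow x m = spow y n"
      unfolding power_class_iff by blast
    have "x \<rightarrow>\<^sup>*\<^bsub>with_proj cyclic_graph\<^esub> spow x m"
      using \<open>m \<ge> 1\<close> by (rule to_power)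
    moreover have "spow x m \<rightarrow>\<^sup>*\<^bsub>with_proj cyclic_graph\<^esub> y"
      unfolding eq using to_power[OF \<open>n \<ge> 1\<close>] by (rule symmetric_reachable')
    ultimately show "x \<rightarrow>\<^sup>*\<^bsub>with_proj cyclic_graph\<^esub> y"
      by (rule reachable_trans)
  qed
qed

theorem proposition3p1:
  fixes x :: "'a::semigroup_mult"
  shows "power_class x \<in> connected_components (cyclic_graph :: 'a pair_pre_digraph)
    \<and> connected_components (cyclic_graph :: 'a pair_pre_digraph) = {power_class z | z :: 'a. True}"
proof -
  have "pair_sym_digraph (cyclic_graph :: 'a pair_pre_digraph)"
    using cyclic_graph_simple by (rule pair_bidirected_digraph.axioms(1))
  from connected_components_eq_reachable_classes[OF this]
  have "connected_components (cyclic_graph :: 'a pair_pre_digraph) = range power_class"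
    unfolding cyclic_graph_reachable_iff by (simp add: cyclic_graph_def)
  then show ?thesis by auto
qed

end
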